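(* For all $k\ge 2$, the Thompson-Higman monoids ${\it Inv}_{k,1}$ and $M_{k,1}$ are congruence-simple.
   Context: Let $k\ge 2$ and $A=\{a_1,\dots,a_k\}$ an alphabet; $A^*$ is the set of all finite words over $A$, with empty word $\varepsilon$. A right ideal of $A^*$ is a set $R\subseteq A^*$ with $RA^*\subseteq R$ (the empty set is allowed). A prefix code is a set $C\subseteq A^*$ in which no element is a prefix of another element. Every right ideal $R$ equals $CA^*$ for a unique prefix code $C$; $R$ is finitely generated iff $C$ is finite. A right ideal homomorphism is a total function $\varphi: R_1\to A^*$, where $R_1={\rm Dom}(\varphi)$ is a right ideal, with $\varphi(xw)=\varphi(x)w$ for all $x\in R_1$, $w\in A^*$; an injective one is called a right ideal isomorphism (onto its image). For right ideals $R'\subseteq R$, $R'$ is essential in $R$ iff $R'$ intersects every non-empty right ideal contained in $R$. $\varphi$ is an essential extension of $\Phi$ iff ${\rm Dom}(\Phi)$ is contained and essential in ${\rm Dom}(\varphi)$ and $\varphi=\Phi$ on ${\rm Dom}(\Phi)$. Every right ideal homomorphism $\varphi$ with finitely generated domain has a unique maximal essential extension $\max(\varphi)$. $M_{k,1}$ is the monoid of all maximal essential extensions of right ideal homomorphisms between finitely generated right ideals of $A^*$, with multiplication $\varphi\cdot\psi=\max(\varphi\circ\psi)$; its zero element is the empty map. ${\it Inv}_{k,1}$ is the submonoid of maximal essential extensions of isomorphisms between finitely generated (not necessarily essential) right ideals. A monoid $M$ is congruence-simple iff the only congruences on $M$ are the equality relation and the congruence that puts all elements of $M$ into one class. *)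

theory Defs
  imports "HOL-Algebra.Group"
begin

text \<open>
  The alphabet is a finite type \<open>'a\<close> (so \<open>k = CARD('a)\<close>), the free monoid of words over it is
  \<open>'a list\<close>, and a function whose domain is a subset of the words is a map
  \<open>'a list \<rightharpoonup> 'a list\<close>, with \<open>dom\<close> and \<open>ran\<close> as domain and image.
\<close>

definition right_ideal :: "'a list set \<Rightarrow> bool" where
  "right_ideal R \<longleftrightarrow> (\<forall>x\<in>R. \<forall>w. x @ w \<in> R)"

definition fin_gen_right_ideal :: "'a list set \<Rightarrow> bool" where
  "fin_gen_right_ideal R \<longleftrightarrow> (\<exists>C. finite C \<and> R = {c @ w |c w. c \<in> C})"

definition essential_in :: "'a list set \<Rightarrow> 'a list set \<Rightarrow> bool" where
  "essential_in R' R \<longleftrightarrow> right_ideal R' \<and> right_ideal R \<and> R' \<subseteq> R \<and>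
     (\<forall>I. right_ideal I \<and> I \<noteq> {} \<and> I \<subseteq> R \<longrightarrow> R' \<inter> I \<noteq> {})"

definition right_ideal_hom :: "('a list \<rightharpoonup> 'a list) \<Rightarrow> bool" where
  "right_ideal_hom \<phi> \<longleftrightarrow> right_ideal (dom \<phi>) \<and>
     (\<forall>x\<in>dom \<phi>. \<forall>w. the (\<phi> (x @ w)) = the (\<phi> x) @ w)"

definition right_ideal_iso :: "('a list \<rightharpoonup> 'a list) \<Rightarrow> bool" where
  "right_ideal_iso \<phi> \<longleftrightarrow> right_ideal_hom \<phi> \<and> inj_on \<phi> (dom \<phi>)"

definition essential_extension :: "('a list \<rightharpoonup> 'a list) \<Rightarrow> ('a list \<rightharpoonup> 'a list) \<Rightarrow> bool" where
  "essential_extension \<phi> \<Phi> \<longleftrightarrow> right_ideal_hom \<phi> \<and> right_ideal_hom \<Phi> \<and>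
     essential_in (dom \<Phi>) (dom \<phi>) \<and> (\<forall>x\<in>dom \<Phi>. \<phi> x = \<Phi> x)"

definition maximal_essential_extension :: "('a list \<rightharpoonup> 'a list) \<Rightarrow> ('a list \<rightharpoonup> 'a list) \<Rightarrow> bool" where
  "maximal_essential_extension \<phi> \<Phi> \<longleftrightarrow> essential_extension \<phi> \<Phi> \<and>
     (\<forall>\<psi>. essential_extension \<psi> \<Phi> \<and> \<phi> \<subseteq>\<^sub>m \<psi> \<longrightarrow> \<psi> = \<phi>)"

definition max_ext :: "('a list \<rightharpoonup> 'a list) \<Rightarrow> ('a list \<rightharpoonup> 'a list)" where
  "max_ext \<Phi> = (THE \<phi>. maximal_essential_extension \<phi> \<Phi>)"

text \<open>
  The definite description above is justified: every right ideal homomorphism has exactly one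
  maximal essential extension, namely the union of all its essential extensions.
\<close>

lemma right_ideal_homD:
  assumes "right_ideal_hom \<phi>" "\<phi> x = Some y"
  shows "\<phi> (x @ w) = Some (y @ w)"
proof -
  have x: "x \<in> dom \<phi>" using assms(2) by blast
  then have "x @ w \<in> dom \<phi>"
    using assms(1) unfolding right_ideal_hom_def right_ideal_def by blast
  moreover have "the (\<phi> (x @ w)) = y @ w"
    using assms x unfolding right_ideal_hom_def by simp
  ultimately show ?thesis by auto
qed

lemma essential_extension_meets:
  assumes "essential_extension \<phi> \<Phi>" "x \<in> dom \<phi>"
  obtains w where "x @ w \<in> dom \<Phi>"
proof -
  let ?I = "{x @ w |w. True}"
  have "right_ideal ?I" by (auto simp: right_ideal_def)
  moreover have "x \<in> ?I" by (metis (mono_tags, lifting) append_Nil2 mem_Collect_eq)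
  moreover have "?I \<subseteq> dom \<phi>"
    using assms by (auto simp: essential_extension_def right_ideal_hom_def right_ideal_def)
  ultimately have "dom \<Phi> \<inter> ?I \<noteq> {}"
    using assms(1) unfolding essential_extension_def essential_in_def by blast
  then show ?thesis using that by auto
qed

lemma essential_extension_agree:
  assumes "essential_extension \<phi> \<Phi>" "essential_extension \<psi> \<Phi>" "\<phi> x = Some y" "\<psi> x = Some z"
  shows "y = z"
proof -
  obtain w where w: "x @ w \<in> dom \<Phi>"
    using essential_extension_meets[OF assms(1)] assms(3) by blast
  have "\<phi> (x @ w) = Some (y @ w)" "\<psi> (x @ w) = Some (z @ w)"
    using assms right_ideal_homD unfolding essential_extension_def by blast+
  moreover have "\<phi> (x @ w) = \<psi> (x @ w)"
    using assms w unfolding essential_extension_def by metis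
  ultimately show ?thesis by simp
qed

lemma ex1_maximal_essential_extension:
  assumes hom: "right_ideal_hom \<Phi>"
  shows "\<exists>!\<phi>. maximal_essential_extension \<phi> \<Phi>"
proof -
  define E where "E = {\<phi>. essential_extension \<phi> \<Phi>}"
  define U where "U = (\<lambda>x. if \<exists>\<phi>\<in>E. x \<in> dom \<phi> then (SOME \<phi>. \<phi> \<in> E \<and> x \<in> dom \<phi>) x else None)"
  have U: "\<phi> \<subseteq>\<^sub>m U" if "\<phi> \<in> E" for \<phi>
    unfolding map_le_def
  proof
    fix x assume x: "x \<in> dom \<phi>"
    let ?\<psi> = "SOME \<phi>. \<phi> \<in> E \<and> x \<in> dom \<phi>"
    have \<psi>: "?\<psi> \<in> E \<and> x \<in> dom ?\<psi>" by (rule someI[of _ \<phi>]) (use that x in simp)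
    have "U x = ?\<psi> x" using that x unfolding U_def by auto
    moreover have "?\<psi> x = \<phi> x"
    proof -
      obtain y z where yz: "?\<psi> x = Some y" "\<phi> x = Some z" using x \<psi> by blast
      have "essential_extension ?\<psi> \<Phi>" "essential_extension \<phi> \<Phi>"
        using \<psi> that unfolding E_def by simp_all
      from essential_extension_agree[OF this yz] yz show ?thesis by simp
    qed
    ultimately show "\<phi> x = U x" by simp
  qed
  have Udom: "\<exists>\<phi>\<in>E. \<phi> x = Some y" if "U x = Some y" for x y
  proof -
    let ?\<psi> = "SOME \<phi>. \<phi> \<in> E \<and> x \<in> dom \<phi>"
    have ex: "\<exists>\<phi>. \<phi> \<in> E \<and> x \<in> dom \<phi>" using that unfolding U_def by (auto split: if_splits)
    then have "?\<psi> \<in> E" using someI_ex[OF ex] by blast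
    moreover have "U x = ?\<psi> x" unfolding U_def by (rule if_P) (use ex in blast)
    then have "?\<psi> x = Some y" using that by simp
    ultimately show ?thesis by blast
  qed
  have homE: "right_ideal_hom \<phi>" if "\<phi> \<in> E" for \<phi>
    using that unfolding E_def essential_extension_def by simp
  have Uapp: "U (x @ w) = Some (y @ w)" if "U x = Some y" for x y w
  proof -
    obtain \<phi> where \<phi>: "\<phi> \<in> E" "\<phi> x = Some y" using Udom \<open>U x = Some y\<close> by blast
    then have "\<phi> (x @ w) = Some (y @ w)" using right_ideal_homD homE by blast
    then show ?thesis using U[OF \<phi>(1)] unfolding map_le_def by (metis domI)
  qed
  have Uhom: "right_ideal_hom U"
    unfolding right_ideal_hom_def right_ideal_def
  proof (intro conjI ballI allI)
    fix x w assume "x \<in> dom U"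
    then obtain y where y: "U x = Some y" by blast
    show "x @ w \<in> dom U" using Uapp[OF y] by blast
    show "the (U (x @ w)) = the (U x) @ w" using Uapp[OF y] y by simp
  qed
  have "essential_in (dom \<Phi>) (dom \<Phi>)"
    using hom unfolding essential_in_def right_ideal_hom_def by blast
  then have \<Phi>: "\<Phi> \<in> E" using hom unfolding E_def essential_extension_def by simp
  have "dom \<Phi> \<inter> I \<noteq> {}" if I: "right_ideal I" "I \<noteq> {}" "I \<subseteq> dom U" for I
  proof -
    obtain x y where "x \<in> I" "U x = Some y" using I by blast
    moreover then obtain \<phi> where "\<phi> \<in> E" "x \<in> dom \<phi>" using Udom by blast
    moreover then obtain w where "x @ w \<in> dom \<Phi>"
      using essential_extension_meets unfolding E_def by blast
    ultimately show ?thesis using I(1) unfolding right_ideal_def by blast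
  qed
  then have UE: "essential_extension U \<Phi>"
    using U[OF \<Phi>] hom Uhom map_le_implies_dom_le[OF U[OF \<Phi>]]
    unfolding essential_extension_def essential_in_def right_ideal_hom_def map_le_def by auto
  show ?thesis
  proof (rule ex1I)
    show "maximal_essential_extension U \<Phi>"
      using UE U unfolding maximal_essential_extension_def E_def
      by (auto intro: map_le_antisym)
  next
    fix \<phi> assume "maximal_essential_extension \<phi> \<Phi>"
    then show "\<phi> = U"
      using UE U unfolding maximal_essential_extension_def E_def by blast
  qed
qed

text \<open>Multiplication is function composition from right to left, followed by maximal extension.\<close>

definition thompson_higman_monoid :: "('a list \<rightharpoonup> 'a list) monoid" where
  "thompson_higman_monoid =
     \<lparr>carrier = {max_ext \<phi> |\<phi>. right_ideal_hom \<phi> \<and>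
                   fin_gen_right_ideal (dom \<phi>) \<and> fin_gen_right_ideal (ran \<phi>)},
      mult = (\<lambda>\<phi> \<psi>. max_ext (\<phi> \<circ>\<^sub>m \<psi>)),
      one = Some\<rparr>"

definition thompson_higman_inv :: "('a list \<rightharpoonup> 'a list) monoid" where
  "thompson_higman_inv =
     thompson_higman_monoid
       \<lparr>carrier := {max_ext \<phi> |\<phi>. right_ideal_iso \<phi> \<and>
                      fin_gen_right_ideal (dom \<phi>) \<and> fin_gen_right_ideal (ran \<phi>)}\<rparr>"

definition monoid_congruence :: "('m, 'b) monoid_scheme \<Rightarrow> ('m \<times> 'm) set \<Rightarrow> bool" where
  "monoid_congruence M r \<longleftrightarrow> equiv (carrier M) r \<and>
     (\<forall>a b c d. (a, b) \<in> r \<and> (c, d) \<in> r \<longrightarrow> (a \<otimes>\<^bsub>M\<^esub> c, b \<otimes>\<^bsub>M\<^esub> d) \<in> r)"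

definition congruence_simple :: "('m, 'b) monoid_scheme \<Rightarrow> bool" where
  "congruence_simple M \<longleftrightarrow>
     (\<forall>r. monoid_congruence M r \<longrightarrow> r = Id_on (carrier M) \<or> r = carrier M \<times> carrier M)"

end

theory Submission
  imports Defs
begin

text \<open>
  A congruence that identifies the identity with the zero element identifies everything, since
  \<open>c = c \<cdot> 1\<close> is then congruent to \<open>c \<cdot> 0 = 0\<close> for each \<open>c\<close>. So it suffices to derive \<open>1 \<equiv> 0\<close> from
  any nontrivial pair \<open>\<phi> \<equiv> \<psi>\<close>.

  Let \<open>\<phi> \<noteq> \<psi>\<close> be maximal. If every word of either domain could be extended into the other
  domain, and \<open>\<phi>\<close> and \<open>\<psi>\<close> agreed wherever both are defined, then their union would be an essential
  extension of both, so that \<open>\<phi> = \<psi>\<close> by maximality. Hence, up to exchanging \<open>\<phi>\<close> and \<open>\<psi>\<close>, some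
  \<open>\<phi> x = y\<close> is separated from \<open>\<psi>\<close>: either \<open>\<psi>\<close> is undefined on \<open>x A\<^sup>*\<close>, or \<open>\<psi> x\<close> differs
  from \<open>y\<close>; in the second case a further letter appended to \<open>x\<close>, if necessary, makes the two images
  prefix-incomparable, and this is where two distinct letters are required
  (\<open>maximal_homs_separated\<close>). In both cases no value of \<open>\<psi>\<close> on \<open>x A\<^sup>*\<close> is comparable
  with \<open>y\<close>. Now multiply on the right by \<open>w \<mapsto> x w\<close> and on the left by \<open>y w \<mapsto> w\<close>: this turns \<open>\<phi>\<close>
  into the identity and \<open>\<psi>\<close> into the empty map (\<open>sandwich_eq_one\<close>, \<open>sandwich_eq_zero\<close>), so \<open>1 \<equiv> 0\<close>.

  The two multipliers are isomorphisms between principal right ideals, so they lie in both monoids,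
  and one argument covers both (\<open>congruence_simple_if_principal_isos\<close>).
\<close>

section \<open>Maximal homomorphisms\<close>

definition maximal_hom :: "('a list \<rightharpoonup> 'a list) \<Rightarrow> bool" where
  "maximal_hom \<phi> \<longleftrightarrow> right_ideal_hom \<phi> \<and> (\<forall>\<psi>. essential_extension \<psi> \<phi> \<longrightarrow> \<psi> = \<phi>)"

lemma right_ideal_homI:
  assumes "\<And>x y w. \<phi> x = Some y \<Longrightarrow> \<phi> (x @ w) = Some (y @ w)"
  shows "right_ideal_hom \<phi>"
  unfolding right_ideal_hom_def right_ideal_def using assms by fastforce

lemma right_ideal_hom_comp:
  assumes "right_ideal_hom \<phi>" "right_ideal_hom \<psi>"
  shows "right_ideal_hom (\<phi> \<circ>\<^sub>m \<psi>)"
proof (rule right_ideal_homI)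
  fix x y w assume "(\<phi> \<circ>\<^sub>m \<psi>) x = Some y"
  then obtain z where "\<psi> x = Some z" "\<phi> z = Some y"
    by (auto simp: map_comp_Some_iff)
  then have "\<psi> (x @ w) = Some (z @ w)" "\<phi> (z @ w) = Some (y @ w)"
    using assms right_ideal_homD by blast+
  then show "(\<phi> \<circ>\<^sub>m \<psi>) (x @ w) = Some (y @ w)"
    by simp
qed

text \<open>
  Essentiality only has to be tested on principal right ideals, that is, by extending single words.
\<close>

lemma essential_extensionI:
  assumes "right_ideal_hom \<phi>" "right_ideal_hom \<Phi>" "\<Phi> \<subseteq>\<^sub>m \<phi>"
    and ext: "\<And>x. x \<in> dom \<phi> \<Longrightarrow> \<exists>w. x @ w \<in> dom \<Phi>"
  shows "essential_extension \<phi> \<Phi>"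
proof -
  have "dom \<Phi> \<inter> I \<noteq> {}" if I: "right_ideal I" "I \<noteq> {}" "I \<subseteq> dom \<phi>" for I
  proof -
    obtain x where "x \<in> I" using I by blast
    moreover then obtain w where "x @ w \<in> dom \<Phi>" using ext I by blast
    ultimately show ?thesis using I(1) unfolding right_ideal_def by blast
  qed
  then show ?thesis
    using assms(1-3) map_le_implies_dom_le[OF assms(3)]
    unfolding essential_extension_def essential_in_def right_ideal_hom_def map_le_def by auto
qed

lemma essential_extension_map_le: "essential_extension \<phi> \<Phi> \<Longrightarrow> \<Phi> \<subseteq>\<^sub>m \<phi>"
  unfolding essential_extension_def map_le_def by auto

lemma essential_extension_trans:
  assumes "essential_extension \<chi> \<phi>" "essential_extension \<phi> \<psi>"
  shows "essential_extension \<chi> \<psi>"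
proof (rule essential_extensionI)
  show "right_ideal_hom \<chi>" "right_ideal_hom \<psi>"
    using assms unfolding essential_extension_def by auto
  show "\<psi> \<subseteq>\<^sub>m \<chi>"
    using assms by (blast intro: map_le_trans essential_extension_map_le)
next
  fix x assume "x \<in> dom \<chi>"
  then obtain w where "x @ w \<in> dom \<phi>"
    using essential_extension_meets[OF assms(1)] by blast
  then obtain w' where "(x @ w) @ w' \<in> dom \<psi>"
    using essential_extension_meets[OF assms(2)] by blast
  then show "\<exists>w. x @ w \<in> dom \<psi>"
    by (metis append.assoc)
qed

lemma max_ext_maximal_essential_extension:
  "right_ideal_hom \<Phi> \<Longrightarrow> maximal_essential_extension (max_ext \<Phi>) \<Phi>"
  unfolding max_ext_def by (rule theI'[OF ex1_maximal_essential_extension])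

lemma max_ext_essential_extension:
  "right_ideal_hom \<Phi> \<Longrightarrow> essential_extension (max_ext \<Phi>) \<Phi>"
  using max_ext_maximal_essential_extension unfolding maximal_essential_extension_def by blast

lemma maximal_hom_max_ext:
  assumes "right_ideal_hom \<Phi>"
  shows "maximal_hom (max_ext \<Phi>)"
proof -
  have "\<psi> = max_ext \<Phi>" if \<psi>: "essential_extension \<psi> (max_ext \<Phi>)" for \<psi>
    using max_ext_maximal_essential_extension[OF assms] essential_extension_map_le[OF \<psi>]
      essential_extension_trans[OF \<psi> max_ext_essential_extension[OF assms]]
    unfolding maximal_essential_extension_def by blast
  then show ?thesis
    using max_ext_essential_extension[OF assms]
    unfolding maximal_hom_def essential_extension_def by blast
qed

lemma max_ext_maximal_hom: "maximal_hom \<phi> \<Longrightarrow> max_ext \<phi> = \<phi>"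
  unfolding maximal_hom_def using max_ext_essential_extension by blast

lemma max_ext_eq_Some:
  assumes "right_ideal_hom \<Phi>" "\<Phi> x = Some y"
  shows "max_ext \<Phi> x = Some y"
  using max_ext_essential_extension[OF assms(1)] assms(2)
  unfolding essential_extension_def by (metis domI)

lemma maximal_hom_empty: "maximal_hom Map.empty"
proof -
  have "right_ideal_hom Map.empty" by (rule right_ideal_homI) simp
  moreover have "\<psi> = Map.empty" if "essential_extension \<psi> Map.empty" for \<psi>
    using essential_extension_meets[OF that] by fastforce
  ultimately show ?thesis unfolding maximal_hom_def by blast
qed

lemma max_ext_total:
  assumes "right_ideal_hom \<phi>" "dom \<phi> = UNIV"
  shows "max_ext \<phi> = \<phi>"
  using max_ext_essential_extension[OF assms(1)] assms(2)
  unfolding essential_extension_def by auto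

section \<open>Separating distinct maximal homomorphisms\<close>

text \<open>
  If the words are comparable, say \<open>y = z t\<close>, then appending a letter different from the first
  letter of \<open>t\<close> makes \<open>y\<close> and \<open>z\<close> branch just after \<open>z\<close>.
\<close>

lemma make_incomparable:
  fixes y z :: "'a list"
  assumes two: "\<And>c :: 'a. \<exists>d. d \<noteq> c" and "y \<noteq> z"
  shows "\<exists>w. \<forall>u v. y @ w @ u \<noteq> z @ w @ v"
proof (cases "\<forall>u v. y @ u \<noteq> z @ v")
  case True
  then show ?thesis by blast
next
  case False
  then obtain t where t: "y = z @ t \<or> z = y @ t"
    by (auto simp: append_eq_append_conv2)
  then obtain c s where "t = c # s" using \<open>y \<noteq> z\<close> by (cases t) auto
  moreover obtain d where "d \<noteq> c" using two by blast
  ultimately have "\<forall>u v. y @ [d] @ u \<noteq> z @ [d] @ v"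
    using t by auto
  then show ?thesis by blast
qed

text \<open>
  Agreement makes the union a homomorphism; it extends \<open>\<phi>\<close> essentially because \<open>\<psi>\<close> contributes
  only words that can be lengthened into the domain of \<open>\<phi>\<close>.
\<close>

lemma essential_extension_map_add:
  assumes "right_ideal_hom \<phi>" "right_ideal_hom \<psi>"
    and agree: "\<And>x y z. \<phi> x = Some y \<Longrightarrow> \<psi> x = Some z \<Longrightarrow> y = z"
    and meet: "\<And>x. x \<in> dom \<psi> \<Longrightarrow> \<exists>w. x @ w \<in> dom \<phi>"
  shows "essential_extension (\<phi> ++ \<psi>) \<phi>"
proof (rule essential_extensionI)
  have le: "\<phi> \<subseteq>\<^sub>m \<phi> ++ \<psi>"
    using agree unfolding map_le_def map_add_def by (fastforce split: option.splits)
  then show "\<phi> \<subseteq>\<^sub>m \<phi> ++ \<psi>" .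
  show "right_ideal_hom (\<phi> ++ \<psi>)"
  proof (rule right_ideal_homI)
    fix x y w assume "(\<phi> ++ \<psi>) x = Some y"
    then consider "\<psi> x = Some y" | "\<phi> x = Some y" by auto
    then show "(\<phi> ++ \<psi>) (x @ w) = Some (y @ w)"
    proof cases
      case 1
      then show ?thesis using right_ideal_homD[OF assms(2)] by simp
    next
      case 2
      then have "\<phi> (x @ w) = Some (y @ w)" using right_ideal_homD[OF assms(1)] by simp
      then show ?thesis using le unfolding map_le_def by (metis domI)
    qed
  qed
  fix x assume "x \<in> dom (\<phi> ++ \<psi>)"
  then consider "x \<in> dom \<psi>" | "x \<in> dom \<phi>" by auto
  then show "\<exists>w. x @ w \<in> dom \<phi>"
  proof cases
    case 2
    then have "x @ [] \<in> dom \<phi>" by simp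
    then show ?thesis by blast
  qed (rule meet)
qed (rule assms)

text \<open>
  The quantifier over \<open>w\<close> lets one notion cover both ways in which homomorphisms can differ: \<open>\<psi>\<close> may
  be undefined on all of \<open>x A\<^sup>*\<close>, or it may take values there that branch off from \<open>y\<close>.
\<close>

definition separated_at ::
    "('a list \<rightharpoonup> 'a list) \<Rightarrow> ('a list \<rightharpoonup> 'a list) \<Rightarrow> 'a list \<Rightarrow> 'a list \<Rightarrow> bool" where
  "separated_at \<phi> \<psi> x y \<longleftrightarrow>
     \<phi> x = Some y \<and> (\<forall>w z u v. \<psi> (x @ w) = Some z \<longrightarrow> y @ u \<noteq> z @ v)"

lemma maximal_homs_separated:
  fixes \<phi> \<psi> :: "'a list \<rightharpoonup> 'a list"
  assumes two: "\<And>c :: 'a. \<exists>d. d \<noteq> c"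
    and max: "maximal_hom \<phi>" "maximal_hom \<psi>" and "\<phi> \<noteq> \<psi>"
  shows "(\<exists>x y. separated_at \<phi> \<psi> x y) \<or> (\<exists>x y. separated_at \<psi> \<phi> x y)"
proof (rule ccontr)
  assume nosep: "\<not> ?thesis"
  have hom: "right_ideal_hom \<phi>" "right_ideal_hom \<psi>"
    using max unfolding maximal_hom_def by auto
  have meet: "\<exists>w. x @ w \<in> dom \<psi>" if "x \<in> dom \<phi>" for x
    using nosep that unfolding separated_at_def by blast
  have meet': "\<exists>w. x @ w \<in> dom \<phi>" if "x \<in> dom \<psi>" for x
    using nosep that unfolding separated_at_def by blast
  have agree: "y = z" if xyz: "\<phi> x = Some y" "\<psi> x = Some z" for x y z
  proof (rule ccontr)
    assume "y \<noteq> z"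
    then obtain w where w: "\<And>u v. y @ w @ u \<noteq> z @ w @ v"
      using make_incomparable[OF two] by blast
    have \<phi>w: "\<phi> (x @ w) = Some (y @ w)" using right_ideal_homD[OF hom(1) xyz(1)] .
    have \<psi>w: "\<psi> ((x @ w) @ w') = Some (z @ w @ w')" for w'
      using right_ideal_homD[OF hom(2) xyz(2), of "w @ w'"] by simp
    have "separated_at \<phi> \<psi> (x @ w) (y @ w)"
      unfolding separated_at_def using \<phi>w \<psi>w w by auto
    then show False using nosep by blast
  qed
  have "\<phi> ++ \<psi> = \<phi>"
  proof -
    have "essential_extension (\<phi> ++ \<psi>) \<phi>"
      by (rule essential_extension_map_add[OF hom]) (use agree meet' in auto)
    then show ?thesis using max(1) unfolding maximal_hom_def by blast
  qed
  moreover have "\<psi> ++ \<phi> = \<psi>"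
  proof -
    have "essential_extension (\<psi> ++ \<phi>) \<psi>"
      by (rule essential_extension_map_add[OF hom(2,1)]) (use agree meet in auto)
    then show ?thesis using max(2) unfolding maximal_hom_def by blast
  qed
  ultimately show False
    using \<open>\<phi> \<noteq> \<psi>\<close> by (metis map_add_le_mapI map_le_antisym map_le_map_add map_le_refl)
qed

section \<open>Sandwiching between principal isomorphisms\<close>

definition principal_iso :: "'a list \<Rightarrow> 'a list \<Rightarrow> 'a list \<rightharpoonup> 'a list" where
  "principal_iso u v x = (if \<exists>w. x = u @ w then Some (v @ drop (length u) x) else None)"

lemma principal_iso_append [simp]: "principal_iso u v (u @ w) = Some (v @ w)"
  by (simp add: principal_iso_def)

lemma principal_iso_Some_iff: "principal_iso u v x = Some y \<longleftrightarrow> (\<exists>w. x = u @ w \<and> y = v @ w)"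
  by (auto simp: principal_iso_def)

lemma dom_principal_iso: "dom (principal_iso u v) = {u @ w |w. True}"
  by (auto simp: dom_def principal_iso_Some_iff)

lemma ran_principal_iso: "ran (principal_iso u v) = {v @ w |w. True}"
  by (auto simp: ran_def principal_iso_Some_iff)

lemma right_ideal_hom_principal_iso: "right_ideal_hom (principal_iso u v)"
  by (rule right_ideal_homI) (auto simp: principal_iso_Some_iff)

lemma right_ideal_iso_principal_iso: "right_ideal_iso (principal_iso u v)"
  unfolding right_ideal_iso_def
  by (auto simp: right_ideal_hom_principal_iso dom_principal_iso intro!: inj_onI)

lemma fin_gen_principal: "fin_gen_right_ideal {u @ w |w. True}"
  unfolding fin_gen_right_ideal_def by (rule exI[of _ "{u}"]) auto

lemma max_ext_principal_iso_Nil: "max_ext (principal_iso [] x) = principal_iso [] x"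
  by (rule max_ext_total) (auto simp: right_ideal_hom_principal_iso dom_principal_iso)

text \<open>
  This is the product of three monoid elements, bracketed to the left. Each principal isomorphism
  is replaced by its maximal extension, so that membership in the monoids is immediate.
\<close>

definition sandwich :: "'a list \<Rightarrow> 'a list \<Rightarrow> ('a list \<rightharpoonup> 'a list) \<Rightarrow> 'a list \<rightharpoonup> 'a list" where
  "sandwich x y \<phi> =
     max_ext (max_ext (max_ext (principal_iso y []) \<circ>\<^sub>m \<phi>) \<circ>\<^sub>m max_ext (principal_iso [] x))"

lemma right_ideal_hom_max_ext_principal_iso:
  "right_ideal_hom (max_ext (principal_iso u v))"
  using maximal_hom_max_ext[OF right_ideal_hom_principal_iso] unfolding maximal_hom_def by blast

lemma sandwich_eq_one:
  assumes \<phi>: "right_ideal_hom \<phi>" and "\<phi> x = Some y"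
  shows "sandwich x y \<phi> = Some"
proof -
  let ?L = "max_ext (principal_iso y []) \<circ>\<^sub>m \<phi>"
  have "max_ext ?L (x @ w) = Some w" for w
  proof (rule max_ext_eq_Some)
    show "right_ideal_hom ?L"
      using \<phi> right_ideal_hom_comp right_ideal_hom_max_ext_principal_iso by blast
    have "\<phi> (x @ w) = Some (y @ w)"
      using right_ideal_homD assms by blast
    moreover have "max_ext (principal_iso y []) (y @ w) = Some w"
      by (rule max_ext_eq_Some) (simp_all add: right_ideal_hom_principal_iso)
    ultimately show "?L (x @ w) = Some w" by simp
  qed
  then have "max_ext ?L \<circ>\<^sub>m principal_iso [] x = Some"
    by (simp add: fun_eq_iff map_comp_def principal_iso_def)
  moreover have "max_ext (Some :: 'a list \<rightharpoonup> 'a list) = Some"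
    by (rule max_ext_total) (auto intro: right_ideal_homI)
  ultimately show ?thesis
    unfolding sandwich_def max_ext_principal_iso_Nil by simp
qed

text \<open>
  Passing to maximal extensions cannot create a value on \<open>x A\<^sup>*\<close>, because every word in the domain of
  a maximal extension can be lengthened into the original domain, while separation persists under
  lengthening both arguments and values.
\<close>

lemma sandwich_eq_zero:
  assumes \<psi>: "right_ideal_hom \<psi>" and sep: "separated_at \<phi> \<psi> x y"
  shows "sandwich x y \<psi> = Map.empty"
proof -
  let ?p = "principal_iso y []"
  let ?L = "max_ext ?p \<circ>\<^sub>m \<psi>"
  have homL: "right_ideal_hom ?L"
    using \<psi> right_ideal_hom_comp right_ideal_hom_max_ext_principal_iso by blast
  have "x @ w \<notin> dom (max_ext ?L)" for w
  proof
    assume "x @ w \<in> dom (max_ext ?L)"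
    then obtain w' where "(x @ w) @ w' \<in> dom ?L"
      using essential_extension_meets[OF max_ext_essential_extension[OF homL]] by blast
    then obtain z where z: "\<psi> (x @ w @ w') = Some z" "z \<in> dom (max_ext ?p)"
      by (auto simp: map_comp_Some_iff dom_def)
    then obtain v where "z @ v \<in> dom ?p"
      using essential_extension_meets[OF max_ext_essential_extension[OF right_ideal_hom_principal_iso]]
      by blast
    then obtain u where "z @ v = y @ u" by (auto simp: dom_principal_iso)
    then show False using z(1) sep unfolding separated_at_def by metis
  qed
  then have "max_ext ?L \<circ>\<^sub>m principal_iso [] x = Map.empty"
    by (auto simp: fun_eq_iff map_comp_def principal_iso_def domIff)
  then show ?thesis
    unfolding sandwich_def max_ext_principal_iso_Nil
    by (simp add: max_ext_maximal_hom maximal_hom_empty)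
qed

section \<open>Congruence-simplicity\<close>

lemma congruence_simple_if_principal_isos:
  fixes M :: "('a list \<rightharpoonup> 'a list, 'b) monoid_scheme"
  assumes two: "\<And>c :: 'a. \<exists>d. d \<noteq> c"
    and mult: "\<And>\<phi> \<psi>. \<phi> \<otimes>\<^bsub>M\<^esub> \<psi> = max_ext (\<phi> \<circ>\<^sub>m \<psi>)"
    and maximal: "\<And>\<phi>. \<phi> \<in> carrier M \<Longrightarrow> maximal_hom \<phi>"
    and principal: "\<And>u v. max_ext (principal_iso u v) \<in> carrier M"
  shows "congruence_simple M"
  unfolding congruence_simple_def
proof (intro allI impI)
  fix r assume cong: "monoid_congruence M r"
  then have eq: "equiv (carrier M) r"
    and mul: "\<And>a b c d. (a, b) \<in> r \<Longrightarrow> (c, d) \<in> r \<Longrightarrow> (a \<otimes>\<^bsub>M\<^esub> c, b \<otimes>\<^bsub>M\<^esub> d) \<in> r"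
    unfolding monoid_congruence_def by blast+
  have refl: "(c, c) \<in> r" if "c \<in> carrier M" for c
    using eq that by (meson equivE refl_onD)
  have sym: "(b, a) \<in> r" if "(a, b) \<in> r" for a b
    using eq that by (meson equivE symD)
  have trans: "(a, c) \<in> r" if "(a, b) \<in> r" "(b, c) \<in> r" for a b c
    using eq that by (meson equivE transD)
  have sub: "r \<subseteq> carrier M \<times> carrier M"
    using eq by (rule equiv_type)
  show "r = Id_on (carrier M) \<or> r = carrier M \<times> carrier M"
  proof (cases "r \<subseteq> Id")
    case True
    then have "r = Id_on (carrier M)" using sub refl by blast
    then show ?thesis ..
  next
    case False
    then obtain \<phi> \<psi> where "(\<phi>, \<psi>) \<in> r" "\<phi> \<noteq> \<psi>" by auto
    then have "(\<exists>x y. separated_at \<phi> \<psi> x y) \<or> (\<exists>x y. separated_at \<psi> \<phi> x y)"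
      using maximal_homs_separated[OF two] maximal sub by blast
    then obtain \<phi>' \<psi>' x y where r': "(\<phi>', \<psi>') \<in> r" and sep: "separated_at \<phi>' \<psi>' x y"
      using \<open>(\<phi>, \<psi>) \<in> r\<close> sym by blast
    have hom: "right_ideal_hom \<phi>'" "right_ideal_hom \<psi>'"
      using r' sub maximal unfolding maximal_hom_def by blast+
    have "(sandwich x y \<phi>', sandwich x y \<psi>') \<in> r"
      unfolding sandwich_def mult[symmetric] by (intro mul refl principal r')
    moreover have "sandwich x y \<phi>' = Some"
      using sandwich_eq_one[OF hom(1)] sep unfolding separated_at_def by blast
    moreover have "sandwich x y \<psi>' = Map.empty"
      by (rule sandwich_eq_zero[OF hom(2) sep])
    ultimately have one_zero: "(Some, Map.empty) \<in> r" by simp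
    have zero: "(c, Map.empty) \<in> r" if c: "c \<in> carrier M" for c
    proof -
      have "(max_ext (c \<circ>\<^sub>m Some), max_ext (c \<circ>\<^sub>m Map.empty)) \<in> r"
        using mul[OF refl[OF c] one_zero] unfolding mult .
      moreover have "c \<circ>\<^sub>m Some = c" "c \<circ>\<^sub>m Map.empty = Map.empty"
        by (auto simp: map_comp_def)
      ultimately show ?thesis
        by (simp add: max_ext_maximal_hom maximal[OF c] maximal_hom_empty)
    qed
    have "carrier M \<times> carrier M \<subseteq> r"
      using zero sym trans by blast
    then show ?thesis using sub by blast
  qed
qed

theorem theorem2p3:
  fixes k :: nat
  assumes "k \<ge> 2" and "card (UNIV :: 'a::finite set) = k"
  shows "congruence_simple (thompson_higman_inv :: ('a list \<rightharpoonup> 'a list) monoid)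
       \<and> congruence_simple (thompson_higman_monoid :: ('a list \<rightharpoonup> 'a list) monoid)"
proof
  have two: "\<exists>d. d \<noteq> c" for c :: 'a
  proof (rule ccontr)
    assume "\<not> ?thesis"
    then have "(UNIV :: 'a set) = {c}" by auto
    then have "card (UNIV :: 'a set) = card {c}" by (rule arg_cong)
    then show False using assms by simp
  qed
  show "congruence_simple (thompson_higman_inv :: ('a list \<rightharpoonup> 'a list) monoid)"
  proof (rule congruence_simple_if_principal_isos[OF two])
    show "max_ext (principal_iso u v) \<in> carrier thompson_higman_inv" for u v :: "'a list"
      unfolding thompson_higman_inv_def
      using right_ideal_iso_principal_iso[of u v] fin_gen_principal
      by (auto simp: dom_principal_iso ran_principal_iso intro!: exI[of _ "principal_iso u v"])
  qed (auto simp: thompson_higman_inv_def thompson_higman_monoid_def right_ideal_iso_def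
      intro: maximal_hom_max_ext)
  show "congruence_simple (thompson_higman_monoid :: ('a list \<rightharpoonup> 'a list) monoid)"
  proof (rule congruence_simple_if_principal_isos[OF two])
    show "max_ext (principal_iso u v) \<in> carrier thompson_higman_monoid" for u v :: "'a list"
      unfolding thompson_higman_monoid_def
      using right_ideal_hom_principal_iso[of u v] fin_gen_principal
      by (auto simp: dom_principal_iso ran_principal_iso intro!: exI[of _ "principal_iso u v"])
  qed (auto simp: thompson_higman_monoid_def intro: maximal_hom_max_ext)
qed

end
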